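(* Let $q=p^f$ be an odd prime power, where $p$ is an odd prime and $f$ is a positive integer, and let $x_1,x_2,\dots,x_{q-1}$ be an enumeration of all the non-zero elements of the finite field $\mathbb{F}_q$. Let $A_q(1)=\left[K_q(x_i+x_j)\right]_{1\le i,j\le q-1}$, where $K_q(b)$ denotes the Kloosterman sum over $\mathbb{F}_q$. Then $$\det A_q(1)=(-1)^{(q-1)/2}q^{q-2}.$$
   Context: Let $\zeta_p=e^{2\pi i/p}\in\mathbb{C}$, let $\mathbb{F}_q^{\times}=\mathbb{F}_q\setminus\{0\}$, and let $\mathrm{Tr}:\mathbb{F}_q\to\mathbb{F}_p$ be the trace map $\mathrm{Tr}(x)=x+x^p+\cdots+x^{p^{f-1}}$. For $b\in\mathbb{F}_q$ (including $b=0$), the Kloosterman sum is $$K_q(b)=\sum_{x\in\mathbb{F}_q^{\times}}\zeta_p^{\mathrm{Tr}\left(x+\frac{b}{x}\right)}\in\mathbb{C}.$$ *)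

theory Defs
  imports Complex_Main "HOL-Computational_Algebra.Computational_Algebra"
    "HOL-Library.Cardinality" "HOL-Number_Theory.Residues" "Jordan_Normal_Form.Determinant"
begin

text \<open>
  The field with \<open>q = p ^ f\<close> elements is a type \<open>'a :: finite_field\<close> with
  \<open>CARD('a) = p ^ f\<close>; \<open>p\<close> and \<open>f\<close> are passed explicitly to the notions depending on them.
\<close>

definition ff_trace :: "nat \<Rightarrow> nat \<Rightarrow> 'a :: field \<Rightarrow> 'a" where
  "ff_trace p f x = (\<Sum>i<f. x ^ (p ^ i))"

text \<open>
  The trace lies in the prime subfield \<open>{of_nat n | n. n < p}\<close>. As an exponent of a \<open>p\<close>-th root
  of unity it is read through its representative in \<open>{0..<p}\<close>, which exists and is unique by
  \<open>ex1_prime_residue_ff_trace\<close> below.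
\<close>

definition prime_residue :: "nat \<Rightarrow> 'a :: field \<Rightarrow> nat" where
  "prime_residue p t = (THE n. n < p \<and> of_nat n = t)"

definition zeta :: "nat \<Rightarrow> complex" where
  "zeta p = exp (2 * of_real pi * \<i> / of_nat p)"

definition kloosterman :: "nat \<Rightarrow> nat \<Rightarrow> 'a :: finite_field \<Rightarrow> complex" where
  "kloosterman p f b = (\<Sum>x\<in>UNIV - {0}. zeta p ^ prime_residue p (ff_trace p f (x + b / x)))"

text \<open>Matrix indices of \<^const>\<open>mat\<close> start at 0, the enumeration \<open>x\<close> starts at 1.\<close>

definition kloosterman_matrix ::
  "nat \<Rightarrow> nat \<Rightarrow> (nat \<Rightarrow> 'a :: finite_field) \<Rightarrow> complex mat" where
  "kloosterman_matrix p f x =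
     mat (p ^ f - 1) (p ^ f - 1) (\<lambda>(i, j). kloosterman p f (x (i + 1) + x (j + 1)))"

lemma CHAR_finite_field_type:
  assumes "prime p" "CARD('a :: finite_field) = p ^ f"
  shows "CHAR('a) = p"
proof -
  have "CHAR('a) dvd CARD('a)" by (rule CHAR_dvd_CARD)
  moreover have "prime CHAR('a)" by (rule prime_CHAR_semidom[OF finite_imp_CHAR_pos]) simp
  ultimately show ?thesis using assms by (metis prime_dvd_power primes_dvd_imp_eq)
qed

lemma ex1_prime_residue_ff_trace:
  fixes x :: "'a :: finite_field"
  assumes p: "prime p" and card: "CARD('a) = p ^ f"
  shows "\<exists>!n. n < p \<and> of_nat n = ff_trace p f x"
proof -
  have ch: "CHAR('a) = p" using assms by (rule CHAR_finite_field_type)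
  have pc: "prime CHAR('a)" using p ch by simp
  have frob: "ff_trace p f x ^ p = ff_trace p f x"
  proof -
    have "ff_trace p f x ^ p = (\<Sum>i<f. (x ^ p ^ i) ^ p)"
      unfolding ff_trace_def using freshmans_dream_sum[OF pc, where n = p] ch by simp
    also have "\<dots> = (\<Sum>i<f. x ^ p ^ Suc i)"
      by (simp add: power_mult [symmetric] mult.commute)
    also have "\<dots> = (\<Sum>i<f. x ^ p ^ i) + x ^ p ^ f - x ^ p ^ 0"
      by (induction f) simp_all
    also have "\<dots> = ff_trace p f x"
      using finite_field_power_card_eq_same[of x] card by (simp add: ff_trace_def)
    finally show ?thesis .
  qed
  have inj: "inj_on (of_nat :: nat \<Rightarrow> 'a) {..<p}"
    by (auto simp: inj_on_def of_nat_eq_iff_cong_CHAR ch cong_def)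
  let ?P = "Polynomial.monom 1 p - [:0, 1:] :: 'a poly"
  let ?R = "{t :: 'a. poly ?P t = 0}"
  have p1: "1 < p" using p prime_gt_1_nat by blast
  have deg: "degree ?P = p"
    using p1 by (subst diff_conv_add_uminus, subst degree_add_eq_left) (simp_all add: degree_monom_eq)
  then have "?P \<noteq> 0" using p1 by auto
  then have "card ?R \<le> p" using card_poly_roots_bound[of ?P] deg by simp
  moreover have "of_nat ` {..<p} \<subseteq> ?R"
  proof -
    have "of_nat n ^ p = (of_nat n :: 'a)" for n
    proof (induction n)
      case 0
      then show ?case using p1 by simp
    next
      case (Suc n)
      then show ?case
        using freshmans_dream[OF pc, where n = p and x = "1 :: 'a" and y = "of_nat n"] ch by simp
    qed
    then show ?thesis by (auto simp: poly_monom)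
  qed
  moreover have "card (of_nat ` {..<p} :: 'a set) = p" using inj by (simp add: card_image)
  ultimately have "of_nat ` {..<p} = ?R"
    by (metis (no_types, lifting) card_seteq finite)
  moreover have "ff_trace p f x \<in> ?R" using frob by (simp add: poly_monom)
  ultimately have "ff_trace p f x \<in> of_nat ` {..<p}" by simp
  then show ?thesis using inj by (auto simp: inj_on_def)
qed

end

theory Submission
  imports Defs
begin

text \<open>
  Write \<open>q = p ^ f\<close> and let \<open>\<psi>\<close> be the canonical additive character
  \<open>\<psi> a = zeta p ^ Tr a\<close>. Replacing the summation variable by its inverse and using that
  \<open>\<psi>\<close> turns sums into products, a Kloosterman sum at a sum of two elements splits as
  \<open>K (a + b) = (\<Sum>y \<noteq> 0. \<psi> (a * y) * \<psi> (1 / y) * \<psi> (b * y))\<close>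
  (\<open>kloosterman_add\<close>). So the Kloosterman matrix is \<open>B * D * B\<close>, where \<open>B\<close> has the entries \<open>\<psi> (x\<^sub>i * x\<^sub>j)\<close>
  and \<open>D\<close> is diagonal with the entries \<open>\<psi> (1 / x\<^sub>k)\<close>.

  The determinant of \<open>D\<close> is \<open>\<psi>\<close> of the sum of all inverses. This sum is its own negative, hence
  \<open>0\<close> in odd characteristic (\<open>sum_nonzero_inverse\<close>), and \<open>det D = 1\<close>.

  It remains to find the determinant of \<open>B * B\<close>, which is easier to see than that of \<open>B\<close>
  (\<open>det_square_additive_char_matrix\<close>). By the orthogonality relation for \<open>\<psi>\<close>, the \<open>(i, j)\<close> entry is \<open>(\<Sum>y \<noteq> 0. \<psi> ((x\<^sub>i + x\<^sub>j) * y))\<close>, which is \<open>q - 1\<close> if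
  \<open>x\<^sub>i = - x\<^sub>j\<close> and \<open>-1\<close> otherwise. So \<open>B * B\<close> arises from \<open>q I - J\<close>, with \<open>J\<close> the all-ones
  matrix of size \<open>q - 1\<close>, by permuting the rows along \<open>x\<^sub>i \<mapsto> - x\<^sub>i\<close>. The eigenvalues of
  \<open>q I - J\<close> are \<open>q - (q - 1) = 1\<close>, once, and \<open>q\<close>, with multiplicity \<open>q - 2\<close>; its determinant is
  \<open>q ^ (q - 2)\<close> (\<open>det_scalar_plus_constant\<close>). Negation has no fixed point among the nonzero elements, so it is a product of
  \<open>(q - 1) div 2\<close> transpositions, which gives the sign
  (\<open>sign_fixpoint_free_involution\<close>).
\<close>

section \<open>The canonical additive character of a finite field\<close>

definition additive_char :: "nat \<Rightarrow> nat \<Rightarrow> 'a :: finite_field \<Rightarrow> complex" where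
  "additive_char p f x = zeta p ^ prime_residue p (ff_trace p f x)"

lemma ff_trace_add:
  fixes x y :: "'a :: finite_field"
  assumes "prime p" "CARD('a) = p ^ f"
  shows "ff_trace p f (x + y) = ff_trace p f x + ff_trace p f y"
proof -
  have ch: "CHAR('a) = p" using assms by (rule CHAR_finite_field_type)
  then have "(x + y) ^ p ^ i = x ^ p ^ i + y ^ p ^ i" for i
    using freshmans_dream'[where 'a = 'a and m = "p ^ i" and n = i] assms(1) by simp
  then show ?thesis by (simp add: ff_trace_def sum.distrib)
qed

lemma prime_residue_ff_trace:
  fixes x :: "'a :: finite_field"
  assumes "prime p" "CARD('a) = p ^ f"
  shows prime_residue_ff_trace_less: "prime_residue p (ff_trace p f x) < p"
    and of_nat_prime_residue_ff_trace:
      "of_nat (prime_residue p (ff_trace p f x)) = ff_trace p f x"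
  using theI'[OF ex1_prime_residue_ff_trace[OF assms, of x]] by (auto simp: prime_residue_def)

lemma zeta_power_eq_cis: "zeta p ^ k = cis (2 * pi * real k / real p)"
proof -
  have "zeta p = cis (2 * pi / real p)"
    by (simp add: zeta_def cis_conv_exp mult_ac)
  then show ?thesis by (simp add: DeMoivre mult_ac)
qed

lemma zeta_power_self: "p > 0 \<Longrightarrow> zeta p ^ p = 1"
  by (simp add: zeta_power_eq_cis)

lemma zeta_power_mod: "p > 0 \<Longrightarrow> zeta p ^ (k mod p) = zeta p ^ k"
  by (metis div_mult_mod_eq mult.commute mult_1 power_add power_mult power_one zeta_power_self)

lemma zeta_power_neq_1:
  assumes "0 < k" "k < p"
  shows "zeta p ^ k \<noteq> 1"
proof -
  have "inj_on (\<lambda>k. zeta p ^ k) {..<p}"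
    using bij_betw_roots_unity[of p] assms by (simp add: zeta_power_eq_cis bij_betw_def)
  then show ?thesis using assms inj_onD[of "\<lambda>k. zeta p ^ k" "{..<p}" k 0] by auto
qed

text \<open>
  The representatives of \<open>Tr x\<close> and \<open>Tr y\<close> add up to that of \<open>Tr (x + y)\<close> only modulo \<open>p\<close>,
  which is enough because \<open>zeta p\<close> is a \<open>p\<close>-th root of unity.
\<close>

lemma additive_char_add:
  fixes x y :: "'a :: finite_field"
  assumes "prime p" "CARD('a) = p ^ f"
  shows "additive_char p f (x + y) = additive_char p f x * additive_char p f y"
proof -
  let ?r = "\<lambda>x :: 'a. prime_residue p (ff_trace p f x)"
  have "(of_nat (?r (x + y)) :: 'a) = of_nat (?r x + ?r y)"
    by (simp add: of_nat_prime_residue_ff_trace[OF assms] ff_trace_add[OF assms, symmetric])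
  then have "?r (x + y) mod p = (?r x + ?r y) mod p"
    unfolding of_nat_eq_iff_cong_CHAR CHAR_finite_field_type[OF assms] cong_def .
  then have "zeta p ^ ?r (x + y) = zeta p ^ (?r x + ?r y)"
    using assms(1) by (metis prime_gt_0_nat zeta_power_mod)
  then show ?thesis by (simp add: additive_char_def power_add)
qed

lemma additive_char_nonzero: "additive_char p f x \<noteq> 0"
  by (simp add: additive_char_def zeta_def)

lemma additive_char_0:
  assumes "prime p" "CARD('a :: finite_field) = p ^ f"
  shows "additive_char p f (0 :: 'a) = 1"
  using additive_char_add[OF assms, of 0 0] additive_char_nonzero[of p f "0 :: 'a"] by simp

lemma additive_char_sum:
  fixes g :: "'b \<Rightarrow> 'a :: finite_field"
  assumes "prime p" "CARD('a) = p ^ f"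
  shows "additive_char p f (\<Sum>i\<in>I. g i) = (\<Prod>i\<in>I. additive_char p f (g i))"
  by (induction I rule: infinite_finite_induct)
    (simp_all add: additive_char_0[OF assms] additive_char_add[OF assms])

text \<open>
  As a polynomial function the trace has degree at most \<open>p ^ (f - 1)\<close>, so it has too few roots
  to vanish on the whole field.
\<close>

lemma ex_ff_trace_nonzero:
  assumes "prime p" "f > 0" "CARD('a :: finite_field) = p ^ f"
  obtains a :: "'a :: finite_field" where "ff_trace p f a \<noteq> 0"
proof -
  define P :: "'a poly" where "P = (\<Sum>i<f. Polynomial.monom 1 (p ^ i))"
  have p1: "1 < p" using assms(1) prime_gt_1_nat by blast
  \<comment> \<open>The term of degree \<open>1\<close> comes from \<open>i = 0\<close> alone and cannot cancel.\<close>
  have "poly.coeff P 1 = (\<Sum>i<f. if i = 0 then 1 else 0)"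
    unfolding P_def coeff_sum using p1 by (intro sum.cong) (auto simp: nat_power_eq_Suc_0_iff)
  then have "poly.coeff P 1 = 1" using assms(2) by simp
  then have P0: "P \<noteq> 0" by auto
  have "degree P \<le> p ^ (f - 1)"
    unfolding P_def
  proof (intro degree_sum_le)
    fix i assume "i \<in> {..<f}"
    then show "degree (Polynomial.monom (1 :: 'a) (p ^ i)) \<le> p ^ (f - 1)"
      using p1 by (auto simp: degree_monom_eq intro!: power_increasing)
  qed simp
  moreover have "p ^ (f - 1) < p ^ f"
    using p1 assms(2) by (intro power_strict_increasing) auto
  ultimately have "card {t. poly P t = 0} < CARD('a)"
    using card_poly_roots_bound[OF P0] assms(3) by linarith
  then have "{t. poly P t = 0} \<noteq> UNIV" by auto
  moreover have "poly P t = ff_trace p f t" for t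
    by (simp add: P_def ff_trace_def poly_sum poly_monom)
  ultimately show ?thesis using that by auto
qed

text \<open>
  Shifting the summation variable by an \<open>a\<close> of nonzero trace multiplies the sum by
  \<open>\<psi> a \<noteq> 1\<close>.
\<close>

lemma sum_additive_char:
  assumes "prime p" "f > 0" "CARD('a :: finite_field) = p ^ f"
  shows "(\<Sum>x\<in>UNIV. additive_char p f (x :: 'a)) = 0"
proof -
  let ?S = "\<Sum>x\<in>UNIV. additive_char p f (x :: 'a)"
  obtain a :: 'a where a: "ff_trace p f a \<noteq> 0" using ex_ff_trace_nonzero assms by blast
  have "prime_residue p (ff_trace p f a) \<noteq> 0"
    using of_nat_prime_residue_ff_trace[OF assms(1,3), of a] a by (metis of_nat_0)
  then have a1: "additive_char p f a \<noteq> 1"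
    unfolding additive_char_def
    by (intro zeta_power_neq_1 prime_residue_ff_trace_less assms) simp
  have "?S = (\<Sum>x\<in>UNIV. additive_char p f (a + x))"
    by (rule sum.reindex_bij_witness[of _ "\<lambda>x. a + x" "\<lambda>x. x - a"]) auto
  also have "\<dots> = additive_char p f a * ?S"
    by (simp add: additive_char_add[OF assms(1,3)] sum_distrib_left)
  finally show ?thesis using a1 by simp
qed

lemma sum_nonzero_additive_char_mult:
  fixes c :: "'a :: finite_field"
  assumes "prime p" "f > 0" "CARD('a) = p ^ f"
  shows "(\<Sum>x\<in>UNIV - {0}. additive_char p f (c * x)) =
    (if c = 0 then of_nat (p ^ f) else 0) - 1"
proof -
  have "(\<Sum>x\<in>UNIV. additive_char p f (c * x)) = (if c = 0 then of_nat (p ^ f) else 0)"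
  proof (cases "c = 0")
    case True
    then show ?thesis using assms by (simp add: additive_char_0)
  next
    case False
    have "(\<Sum>x\<in>UNIV. additive_char p f (c * x)) = (\<Sum>x\<in>UNIV. additive_char p f (x :: 'a))"
      by (rule sum.reindex_bij_witness[of _ "\<lambda>x. x / c" "\<lambda>x. c * x"]) (use False in auto)
    then show ?thesis using False sum_additive_char[OF assms] by simp
  qed
  then show ?thesis
    using additive_char_0[OF assms(1,3)] by (simp add: sum_diff1)
qed

section \<open>Two determinants\<close>

text \<open>
  Such an involution is a product of disjoint transpositions, one for each two-element orbit;
  the induction strips them off one at a time.
\<close>

lemma sign_fixpoint_free_involution:
  assumes "finite S" "\<And>x. \<pi> (\<pi> x) = x" "\<And>x. \<pi> x \<noteq> x \<longleftrightarrow> x \<in> S"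
  shows "sign \<pi> = (-1) ^ (card S div 2)"
  using assms
proof (induction S arbitrary: \<pi> rule: finite_psubset_induct)
  case (psubset S)
  show ?case
  proof (cases "S = {}")
    case True
    then have "\<pi> = id" using psubset.prems(2) by auto
    then show ?thesis using True by simp
  next
    case False
    then obtain a where a: "a \<in> S" by auto
    define b where "b = \<pi> a"
    define \<rho> where "\<rho> = transpose a b \<circ> \<pi>"
    have ab: "a \<noteq> b" "b \<in> S" "\<pi> b = a"
      using a psubset.prems unfolding b_def by metis+
    have \<rho>: "\<rho> x = (if x = a \<or> x = b then x else \<pi> x)" for x
      using ab psubset.prems(1) unfolding \<rho>_def b_def comp_apply
      by (auto simp: Transposition.transpose_def) metis+
    have inv: "\<rho> (\<rho> x) = x" for x
      using psubset.prems(1)[of x] psubset.prems(1)[of a] ab(3) by (auto simp: \<rho> b_def)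
    have moved: "\<rho> x \<noteq> x \<longleftrightarrow> x \<in> S - {a, b}" for x
      using psubset.prems(2) unfolding \<rho> by auto
    have "sign \<rho> = (-1) ^ (card (S - {a, b}) div 2)"
      by (rule psubset.IH) (use a inv moved in auto)
    moreover have "card S = Suc (Suc (card (S - {a, b})))"
      using a ab(1,2) psubset.hyps card_mono[of S "{a, b}"] by (simp add: card_Diff_subset)
    moreover have "\<pi> = transpose a b \<circ> \<rho>"
      by (simp add: \<rho>_def o_assoc)
    moreover have "permutation \<rho>"
    proof -
      have "\<rho> permutes S"
        unfolding permutes_def using moved inv by (metis Diff_iff)
      then show ?thesis using psubset.hyps permutes_imp_permutation by blast
    qed
    ultimately show ?thesis
      using ab(1) by (simp add: sign_compose permutation_swap_id sign_swap_id del: comp_apply o_apply)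
  qed
qed

text \<open>
  All column sums are equal, so adding all rows to the first one makes that row constant. Subtracting the first column from the others then leaves a
  lower triangular matrix \<open>L\<close>. Both steps are given by the same unitriangular matrix \<open>E\<close>,
  in the form \<open>E * M = L * E\<close>, so that no inverse has to be computed.
\<close>

lemma det_scalar_plus_constant:
  fixes a b :: "'a :: comm_ring_1"
  assumes n: "n > 0"
  shows "det (mat n n (\<lambda>(i, j). (if i = j then a else 0) + b)) = (a + of_nat n * b) * a ^ (n - 1)"
proof -
  define M where "M = mat n n (\<lambda>(i, j). (if i = j then a else 0) + b)"
  define E :: "'a mat" where "E = mat n n (\<lambda>(i, j). if i = 0 \<or> i = j then 1 else 0)"
  define L where "L = mat n n (\<lambda>(i, j).
    if i = 0 then if j = 0 then a + of_nat n * b else 0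
    else if j = 0 then b else if i = j then a else 0)"
  have carr: "M \<in> carrier_mat n n" "E \<in> carrier_mat n n" "L \<in> carrier_mat n n"
    by (simp_all add: M_def E_def L_def)
  have "E * M = L * E"
  proof (rule eq_matI)
    fix i j assume "i < dim_row (L * E)" "j < dim_col (L * E)"
    then have ij: "i < n" "j < n" by (simp_all add: L_def E_def)
    have EM: "(E * M) $$ (i, j) =
        (\<Sum>k\<in>{0..<n}. (if i = 0 \<or> i = k then 1 else 0) * ((if k = j then a else 0) + b))"
      using ij by (simp add: E_def M_def scalar_prod_def)
    have LE: "(L * E) $$ (i, j) = (\<Sum>k\<in>{0..<n}. L $$ (i, k) * E $$ (k, j))"
      using ij carr by (simp add: scalar_prod_def)
    show "(E * M) $$ (i, j) = (L * E) $$ (i, j)"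
    proof (cases "i = 0")
      case True
      have "(L * E) $$ (i, j) = (\<Sum>k\<in>{0..<n}. if k = 0 then a + of_nat n * b else 0)"
        unfolding LE using ij True by (intro sum.cong) (auto simp: L_def E_def)
      then show ?thesis
        using True ij n unfolding EM by (simp add: sum.distrib)
    next
      case False
      have "(L * E) $$ (i, j) =
          (\<Sum>k\<in>{0..<n}. (if k = 0 then b else 0) + (if k = i then if i = j then a else 0 else 0))"
        unfolding LE using ij False by (intro sum.cong) (auto simp: L_def E_def)
      moreover have "(E * M) $$ (i, j) =
          (\<Sum>k\<in>{0..<n}. if k = i then (if i = j then a else 0) + b else 0)"
        unfolding EM using False by (intro sum.cong) auto
      ultimately show ?thesis using ij n by (simp add: sum.distrib)
    qed
  qed (simp_all add: E_def L_def M_def)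
  then have "det E * det M = det L * det E"
    using carr by (metis det_mult)
  moreover have "det E = 1"
  proof -
    have "upper_triangular E" by (auto simp: E_def upper_triangular_def)
    then have "det E = prod_list (diag_mat E)" using carr by (intro det_upper_triangular)
    also have "\<dots> = 1" by (simp add: prod_list_diag_prod E_def)
    finally show ?thesis .
  qed
  moreover have "det L = (a + of_nat n * b) * a ^ (n - 1)"
  proof -
    have "det L = prod_list (diag_mat L)"
      using carr by (intro det_lower_triangular[of n]) (auto simp: L_def)
    also have "\<dots> = (\<Prod>i\<in>{0..<n}. L $$ (i, i))"
      by (simp add: prod_list_diag_prod L_def)
    also have "\<dots> = L $$ (0, 0) * (\<Prod>i\<in>{Suc 0..<n}. L $$ (i, i))"
      using n by (rule prod.atLeast_Suc_lessThan)
    also have "(\<Prod>i\<in>{Suc 0..<n}. L $$ (i, i)) = (\<Prod>i\<in>{Suc 0..<n}. a)"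
      by (intro prod.cong) (auto simp: L_def)
    finally show ?thesis using n by (simp add: L_def)
  qed
  ultimately show ?thesis by (simp add: M_def)
qed

section \<open>The Kloosterman matrix\<close>

text \<open>
  The substitution \<open>y = 1 / x\<close> makes the argument \<open>1 / y + (a + b) * y\<close> linear in \<open>a\<close> and \<open>b\<close>,
  so that \<open>\<psi>\<close> separates them. This is what factors the Kloosterman matrix.
\<close>

lemma kloosterman_add:
  fixes a b :: "'a :: finite_field"
  assumes "prime p" "CARD('a) = p ^ f"
  shows "kloosterman p f (a + b) = (\<Sum>y\<in>UNIV - {0}.
    additive_char p f (a * y) * additive_char p f (1 / y) * additive_char p f (b * y))"
proof -
  have "kloosterman p f (a + b) = (\<Sum>y\<in>UNIV - {0}. additive_char p f (1 / y + (a + b) * y))"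
    unfolding kloosterman_def additive_char_def
    by (rule sum.reindex_bij_witness[of _ inverse inverse]) (auto simp: field_simps)
  also have "\<dots> = (\<Sum>y\<in>UNIV - {0}.
      additive_char p f (a * y) * additive_char p f (1 / y) * additive_char p f (b * y))"
    by (simp add: distrib_right additive_char_add[OF assms] mult.assoc mult.left_commute)
  finally show ?thesis .
qed

lemma two_neq_zero_finite_field:
  assumes "prime p" "odd p" "CARD('a :: finite_field) = p ^ f"
  shows "(2 :: 'a) \<noteq> 0"
proof -
  have "CHAR('a) = p" using assms(1,3) by (rule CHAR_finite_field_type)
  moreover have "\<not> p dvd 2"
    using assms(1,2) by (metis prime_nat_iff two_is_prime_nat dvd_refl not_prime_1)
  ultimately have "of_nat 2 \<noteq> (0 :: 'a)" unfolding of_nat_eq_0_iff_char_dvd by simp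
  then show ?thesis by simp
qed

text \<open>
  The substitution \<open>y \<mapsto> - y\<close> shows that the sum equals its own negative.
\<close>

lemma sum_nonzero_inverse:
  assumes "(2 :: 'a :: finite_field) \<noteq> 0"
  shows "(\<Sum>y\<in>UNIV - {0 :: 'a}. 1 / y) = 0"
proof -
  let ?S = "\<Sum>y\<in>UNIV - {0 :: 'a}. 1 / y"
  have "?S = (\<Sum>y\<in>UNIV - {0 :: 'a}. - (1 / y))"
    by (rule sum.reindex_bij_witness[of _ uminus uminus]) auto
  then have "2 * ?S = 0" by (simp add: sum_negf)
  then show ?thesis using assms by simp
qed

lemma sum_mult_additive_char_enum:
  fixes y :: "nat \<Rightarrow> 'a :: finite_field"
  assumes "prime p" "f > 0" "CARD('a) = p ^ f"
    and y: "bij_betw y {0..<n} (UNIV - {0})"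
  shows "(\<Sum>k = 0..<n. additive_char p f (a * y k) * additive_char p f (y k * b)) =
    (if a + b = 0 then of_nat (p ^ f) else 0) - 1"
proof -
  have "(\<Sum>k = 0..<n. additive_char p f (a * y k) * additive_char p f (y k * b)) =
      (\<Sum>k = 0..<n. additive_char p f ((a + b) * y k))"
    by (simp add: additive_char_add[OF assms(1,3)] algebra_simps)
  also have "\<dots> = (\<Sum>z\<in>UNIV - {0}. additive_char p f ((a + b) * z))"
    by (rule sum.reindex_bij_betw[OF y])
  finally show ?thesis using sum_nonzero_additive_char_mult[OF assms(1-3), of "a + b"] by simp
qed

text \<open>
  Rows are permuted by a permutation of their indices, so negation on the nonzero field elements
  is transported along the enumeration. It has no fixed point because the characteristic is odd.
\<close>

lemma negation_index_permutation:
  fixes y :: "nat \<Rightarrow> 'a :: field"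
  assumes two: "(2 :: 'a) \<noteq> 0" and y: "bij_betw y {0..<n} (UNIV - {0})"
  obtains \<sigma> where "\<sigma> permutes {0..<n}" "sign \<sigma> = (-1) ^ (n div 2)"
    "\<And>i. i < n \<Longrightarrow> y (\<sigma> i) = - y i"
proof -
  define \<sigma> where "\<sigma> i = (if i < n then inv_into {0..<n} y (- y i) else i)" for i
  have nz: "y i \<noteq> 0" if "i < n" for i
    using bij_betwE[OF y] that by auto
  have neg: "y i \<noteq> - y i" if "i < n" for i
  proof
    assume "y i = - y i"
    then have "2 * y i = 0" by (metis add.right_inverse mult_2)
    then show False using two nz[OF that] by simp
  qed
  have y\<sigma>: "y (\<sigma> i) = - y i" and \<sigma>_less: "\<sigma> i < n" if "i < n" for i
  proof -
    have "- y i \<in> y ` {0..<n}" using y nz[OF that] by (auto simp: bij_betw_def)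
    then show "y (\<sigma> i) = - y i" "\<sigma> i < n"
      using that f_inv_into_f[of "- y i" y "{0..<n}"] inv_into_into[of "- y i" y "{0..<n}"]
      by (auto simp: \<sigma>_def)
  qed
  have inv: "\<sigma> (\<sigma> i) = i" for i
  proof (cases "i < n")
    case True
    then have "y (\<sigma> (\<sigma> i)) = y i" by (simp add: y\<sigma> \<sigma>_less)
    then show ?thesis
      using True \<sigma>_less bij_betw_imp_inj_on[OF y] by (auto dest: inj_onD)
  qed (simp add: \<sigma>_def)
  have moved: "\<sigma> i \<noteq> i \<longleftrightarrow> i \<in> {0..<n}" for i
  proof (cases "i < n")
    case True
    then show ?thesis using y\<sigma>[OF True] neg[OF True] by auto
  qed (simp add: \<sigma>_def)
  have "\<sigma> permutes {0..<n}"
    unfolding permutes_def using moved inv by metis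
  moreover have "sign \<sigma> = (-1) ^ (n div 2)"
    using sign_fixpoint_free_involution[of "{0..<n}" \<sigma>] inv moved by simp
  ultimately show ?thesis using y\<sigma> that by blast
qed

text \<open>
  By orthogonality \<open>B * B\<close> is \<open>q I - J\<close> with the rows permuted by negation.
\<close>

lemma det_square_additive_char_matrix:
  fixes y :: "nat \<Rightarrow> 'a :: finite_field"
  assumes p: "prime p" "odd p" "f > 0" "CARD('a) = p ^ f"
    and y: "bij_betw y {0..<p ^ f - 1} (UNIV - {0})"
  defines "B \<equiv> mat (p ^ f - 1) (p ^ f - 1) (\<lambda>(i, j). additive_char p f (y i * y j))"
  shows "det B * det B = (-1) ^ ((p ^ f - 1) div 2) * of_nat (p ^ f) ^ (p ^ f - 2)"
proof -
  define n where "n = p ^ f - 1"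
  have "1 < p ^ f" using p(1,3) by (intro one_less_power prime_gt_1_nat)
  then have n: "n > 0" "p ^ f = n + 1" by (simp_all add: n_def)
  have B: "B \<in> carrier_mat n n" by (simp add: B_def n_def)
  define N :: "complex mat" where
    "N = mat n n (\<lambda>(i, j). (if i = j then of_nat (p ^ f) else 0) + - 1)"
  obtain \<sigma> where \<sigma>: "\<sigma> permutes {0..<n}" "sign \<sigma> = (-1) ^ (n div 2)"
      "\<And>i. i < n \<Longrightarrow> y (\<sigma> i) = - y i"
    using negation_index_permutation[OF two_neq_zero_finite_field[OF p(1,2,4)]] y
    unfolding n_def by blast
  have "B * B = mat n n (\<lambda>(i, j). N $$ (\<sigma> i, j))"
  proof (rule eq_matI)
    fix i j
    assume "i < dim_row (mat n n (\<lambda>(i, j). N $$ (\<sigma> i, j)))"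
      and "j < dim_col (mat n n (\<lambda>(i, j). N $$ (\<sigma> i, j)))"
    then have ij: "i < n" "j < n" by simp_all
    have \<sigma>i: "\<sigma> i < n" using permutes_in_image[OF \<sigma>(1), of i] ij by simp
    have "y i + y j = 0 \<longleftrightarrow> y (\<sigma> i) = y j"
      unfolding \<sigma>(3)[OF ij(1)] add_eq_0_iff by auto
    also have "\<dots> \<longleftrightarrow> \<sigma> i = j"
      using bij_betw_imp_inj_on[OF y] \<sigma>i ij by (auto simp: n_def dest: inj_onD)
    finally have eq: "y i + y j = 0 \<longleftrightarrow> \<sigma> i = j" .
    have "(B * B) $$ (i, j) =
        (\<Sum>k = 0..<n. additive_char p f (y i * y k) * additive_char p f (y k * y j))"
      using ij by (simp add: B_def n_def scalar_prod_def)
    also have "\<dots> = N $$ (\<sigma> i, j)"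
      using sum_mult_additive_char_enum[OF p(1,3,4) y, of "y i" "y j"] ij \<sigma>i
      by (simp add: eq N_def n_def)
    finally show "(B * B) $$ (i, j) = mat n n (\<lambda>(i, j). N $$ (\<sigma> i, j)) $$ (i, j)"
      using ij by simp
  qed (use B in auto)
  then have "det B * det B = det (mat n n (\<lambda>(i, j). N $$ (\<sigma> i, j)))"
    using det_mult[OF B B] by simp
  also have "\<dots> = signof \<sigma> * det N"
    by (intro det_permute_rows \<sigma>) (simp add: N_def)
  also have "det N = (of_nat (p ^ f) + of_nat n * - 1) * of_nat (p ^ f) ^ (n - 1)"
    unfolding N_def by (rule det_scalar_plus_constant[OF n(1)])
  also have "of_nat (p ^ f) + of_nat n * - 1 = (1 :: complex)"
    by (simp add: n(2))
  finally show ?thesis using \<sigma>(2) by (simp add: n_def numeral_2_eq_2)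
qed

lemma bij_betw_shift_enum:
  fixes x :: "nat \<Rightarrow> 'a"
  assumes "bij_betw x {1..n} A"
  shows "bij_betw (\<lambda>i. x (i + 1)) {0..<n} A"
proof -
  have "bij_betw Suc {0..<n} {1..n}"
    by (rule bij_betw_byWitness[where f' = "\<lambda>k. k - 1"]) auto
  from bij_betw_trans[OF this assms] show ?thesis by (simp add: comp_def)
qed

theorem theorem1p1:
  fixes p f :: nat and x :: "nat \<Rightarrow> 'a :: finite_field"
  assumes "prime p" and "odd p" and "f > 0"
    and "CARD('a) = p ^ f"
    and "bij_betw x {1..p ^ f - 1} (UNIV - {0})"
  shows "det (kloosterman_matrix p f x) = (-1) ^ ((p ^ f - 1) div 2) * of_nat (p ^ f) ^ (p ^ f - 2)"
proof -
  define n where "n = p ^ f - 1"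
  define y where "y = (\<lambda>i. x (i + 1))"
  define B where "B = mat n n (\<lambda>(i, j). additive_char p f (y i * y j))"
  define D where "D = mat n n (\<lambda>(i, j). if i = j then additive_char p f (1 / y i) else 0)"
  have y: "bij_betw y {0..<n} (UNIV - {0})"
    using bij_betw_shift_enum[OF assms(5)] by (simp add: n_def y_def)
  have carr: "B \<in> carrier_mat n n" "D \<in> carrier_mat n n"
    by (simp_all add: B_def D_def)
  have BD: "(B * D) $$ (i, k) = additive_char p f (y i * y k) * additive_char p f (1 / y k)"
    if "i < n" "k < n" for i k
  proof -
    have "(B * D) $$ (i, k) = (\<Sum>l = 0..<n. B $$ (i, l) * D $$ (l, k))"
      using that carr by (simp add: scalar_prod_def)
    also have "\<dots> = (\<Sum>l = 0..<n.
        if l = k then additive_char p f (y i * y k) * additive_char p f (1 / y k) else 0)"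
      using that by (intro sum.cong) (auto simp: B_def D_def)
    finally show ?thesis using that by simp
  qed
  have "kloosterman_matrix p f x = B * D * B"
  proof (rule eq_matI)
    fix i j assume "i < dim_row (B * D * B)" "j < dim_col (B * D * B)"
    then have ij: "i < n" "j < n" using carr by simp_all
    have Bkj: "B $$ (k, j) = additive_char p f (y j * y k)" if "k < n" for k
      using ij that by (simp add: B_def mult.commute)
    have "(B * D * B) $$ (i, j) = (\<Sum>k = 0..<n. (B * D) $$ (i, k) * B $$ (k, j))"
      using ij carr by (simp add: scalar_prod_def del: assoc_mult_mat)
    also have "\<dots> = (\<Sum>k = 0..<n. additive_char p f (y i * y k) *
        additive_char p f (1 / y k) * additive_char p f (y j * y k))"
      using ij by (intro sum.cong) (simp_all add: BD Bkj)
    also have "\<dots> = (\<Sum>z\<in>UNIV - {0}. additive_char p f (y i * z) *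
        additive_char p f (1 / z) * additive_char p f (y j * z))"
      by (rule sum.reindex_bij_betw[OF y])
    also have "\<dots> = kloosterman p f (y i + y j)"
      by (rule kloosterman_add[OF assms(1,4), symmetric])
    finally show "kloosterman_matrix p f x $$ (i, j) = (B * D * B) $$ (i, j)"
      using ij by (simp add: kloosterman_matrix_def n_def y_def)
  qed (simp_all add: kloosterman_matrix_def B_def n_def)
  then have "det (kloosterman_matrix p f x) = det B * det D * det B"
    using carr by (metis det_mult mult_carrier_mat)
  moreover have "det D = 1"
  proof -
    have "det D = prod_list (diag_mat D)"
      using carr by (intro det_lower_triangular[of n]) (auto simp: D_def)
    also have "\<dots> = (\<Prod>k = 0..<n. additive_char p f (1 / y k))"
      by (simp add: prod_list_diag_prod D_def)
    also have "\<dots> = (\<Prod>z\<in>UNIV - {0 :: 'a}. additive_char p f (1 / z))"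
      by (rule prod.reindex_bij_betw[OF y])
    also have "\<dots> = additive_char p f (\<Sum>z\<in>UNIV - {0 :: 'a}. 1 / z)"
      by (rule additive_char_sum[OF assms(1,4), symmetric])
    also have "\<dots> = 1"
      unfolding sum_nonzero_inverse[OF two_neq_zero_finite_field[OF assms(1,2,4)]]
      by (rule additive_char_0[OF assms(1,4)])
    finally show ?thesis .
  qed
  moreover have "det B * det B = (-1) ^ ((p ^ f - 1) div 2) * of_nat (p ^ f) ^ (p ^ f - 2)"
    unfolding B_def n_def
    by (rule det_square_additive_char_matrix) (use assms y in \<open>auto simp: n_def\<close>)
  ultimately show ?thesis by simp
qed

end
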